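(* Let $k=\mathbb{R}$, $\dim V=4$, and let $I_3\in\Lambda^3V^{\vee}\otimes\Lambda^2V^{\vee}\otimes\Lambda^3V^{\vee}$ be $$I_3=\begin{bmatrix} e_{123} & -e_{023} & e_{013} & -e_{012} \end{bmatrix}\begin{bmatrix} 0 & e_{01} & e_{02} & e_{03} \\ -e_{01} & 0 & e_{12} & e_{13} \\ -e_{02} & -e_{12} & 0 & e_{23} \\ -e_{03} & -e_{13} & -e_{23} & 0 \end{bmatrix}\begin{bmatrix} e_{123} \\ -e_{023} \\ e_{013} \\ -e_{012} \end{bmatrix},$$ where products of matrix entries are tensor products (the row, matrix and column giving respectively the first, second and third tensor factors). Then the Euclidean reduction $f''(I_3):E^2\to\Lambda^2T^{\vee}\otimes T^{\vee}\otimes\Lambda^2T^{\vee}$ is given by $$\big((r,u),(s,w)\big)\mapsto -r\otimes w+u\otimes s.$$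
   Context: $v_0,\dots,v_3$ is a basis of $V$, $e_0,\dots,e_3$ is the dual basis, $e_{ij}=e_i\wedge e_j$, $e_{ijk}=e_i\wedge e_j\wedge e_k$. $E\subset GL(V)$ is the Euclidean group, consisting of the matrices $g=\begin{bmatrix} 1 & 0 \\ u & r \end{bmatrix}$ (acting on column vectors) with $u\in\mathbb{R}^3$ and $r\in SO(3)$; write $g=(r,u)$. Set $L=[v_0]^{\vee}$ where $[v_0]=\mathbb{R}v_0$, $W=(V/[v_0])^{\vee}$, $T=L\otimes W^{\vee}$. The choice of $v_0$ trivializes $L$, so $L\otimes\Lambda^pW\cong\Lambda^pW\cong\Lambda^pT^{\vee}$. The map $\psi$ sends $\xi\in\Lambda^{p+1}V^{\vee}$ to the function on $GL(V)$ given by $g\mapsto\big(y\mapsto\xi(g(v_0\wedge y))\big)\in\Lambda^pW$, $y\in\Lambda^p(V/[v_0])$. The value $f''(I_3)(g_1,g_2)$ is $(\psi\otimes\psi\otimes\psi)(I_3)$ evaluated at $(g_1^{-1},\mathrm{id},g_2^{-1})\in E^3$; here $g_1=(r,u)$ and $g_2=(s,w)$. Identifications: $T\cong\mathbb{R}^3$ with the basis induced by $v_1,v_2,v_3$, and $\Lambda^2T^{\vee}\cong T$ by $x\mapsto\iota_x(\tilde e_1\wedge\tilde e_2\wedge\tilde e_3)$, where $\tilde e_1,\tilde e_2,\tilde e_3$ is the basis of $T^{\vee}$ induced by $e_1,e_2,e_3$. Accordingly $\Lambda^2T^{\vee}\otimes T^{\vee}\cong T\otimes T^{\vee}\cong\mathrm{End}\,T$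 (in which $r$ lives) and $T^{\vee}\otimes\Lambda^2T^{\vee}\cong T^{\vee}\otimes T\cong\mathrm{End}\,T$ (in which $s$ lives), and $u,w\in T\cong\Lambda^2T^{\vee}$. Thus, with $r_i,s_i$ the columns of $r,s$, $-r\otimes w+u\otimes s$ means $\sum_{i=1}^3(-r_i\otimes\tilde e_i\otimes w+u\otimes\tilde e_i\otimes s_i)$. *)

theory Defs
  imports "HOL-Analysis.Analysis" "HOL-Library.Function_Algebras"
begin

(* \<open>V\<close> is the whole type \<open>'v\<close>.  The basis is \<open>v 0, v 1, v 2, v 3\<close>; in particular \<open>dim V = 4\<close>. *)

definition basis4 :: "(nat \<Rightarrow> 'v::real_vector) \<Rightarrow> bool" where
  "basis4 v \<longleftrightarrow> inj_on v {0..3} \<and> independent (v ` {0..3}) \<and> span (v ` {0..3}) = UNIV"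

definition dual :: "(nat \<Rightarrow> 'v::real_vector) \<Rightarrow> nat \<Rightarrow> 'v \<Rightarrow> real" where
  "dual v i x = representation (v ` {0..3}) x (v i)"


(* A \<open>p\<close>-form (an element of the \<open>p\<close>-th exterior power of the dual space) is an alternating
   multilinear function on lists of \<open>p\<close> vectors, extended by \<open>0\<close> to lists of any other length, so
   that equality of forms is equality of functions.  Its value on \<open>[x\<^sub>1, \<dots>, x\<^sub>p]\<close> is the pairing
   with \<open>x\<^sub>1 \<and> \<dots> \<and> x\<^sub>p\<close>, normalised by the determinant (no factor \<open>1/p!\<close>). *)

type_synonym 'a form = "'a list \<Rightarrow> real"

definition wedge :: "('a \<Rightarrow> real) list \<Rightarrow> 'a form" where
  "wedge \<alpha> xs =
     (if length xs = length \<alpha>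
      then \<Sum>\<sigma> | \<sigma> permutes {..<length \<alpha>}.
             of_int (sign \<sigma>) * (\<Prod>i<length \<alpha>. (\<alpha> ! i) (xs ! \<sigma> i))
      else 0)"

definition interior :: "'a \<Rightarrow> 'a form \<Rightarrow> 'a form" where
  "interior x \<xi> xs = \<xi> (x # xs)"


(* Tensors in \<open>A \<otimes> B \<otimes> C\<close>, for spaces \<open>A, B, C\<close> of real functions on sets \<open>X, Y, Z\<close>, are
   represented by functions of three arguments from \<open>X, Y, Z\<close>. *)

definition tensor3 :: "('a \<Rightarrow> real) \<Rightarrow> ('b \<Rightarrow> real) \<Rightarrow> ('c \<Rightarrow> real) \<Rightarrow> 'a \<Rightarrow> 'b \<Rightarrow> 'c \<Rightarrow> real" where
  "tensor3 \<alpha> \<beta> \<gamma> x y z = \<alpha> x * \<beta> y * \<gamma> z"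

(* The tensor product of three linear maps between function spaces: each map acts on its own
   argument.  See \<open>tensor_map3_sum_tensor3\<close>. *)

definition tensor_map3 ::
  "(('a \<Rightarrow> real) \<Rightarrow> 'a' \<Rightarrow> real) \<Rightarrow> (('b \<Rightarrow> real) \<Rightarrow> 'b' \<Rightarrow> real) \<Rightarrow> (('c \<Rightarrow> real) \<Rightarrow> 'c' \<Rightarrow> real) \<Rightarrow>
   ('a \<Rightarrow> 'b \<Rightarrow> 'c \<Rightarrow> real) \<Rightarrow> 'a' \<Rightarrow> 'b' \<Rightarrow> 'c' \<Rightarrow> real" where
  "tensor_map3 A B C F x y z = A (\<lambda>a. B (\<lambda>b. C (\<lambda>c. F a b c) z) y) x"

definition linear_op :: "(('a \<Rightarrow> real) \<Rightarrow> 'b \<Rightarrow> real) \<Rightarrow> bool" where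
  "linear_op A \<longleftrightarrow> (\<forall>f g. A (f + g) = A f + A g) \<and> (\<forall>c f. A (\<lambda>x. c * f x) = (\<lambda>y. c * A f y))"

lemma sum_fun_eval: "(\<Sum>i\<in>I. f i) x = (\<Sum>i\<in>I. f i x)"
  by (induction I rule: infinite_finite_induct) auto

lemma linear_op_sum:
  assumes "linear_op A"
  shows "A (\<lambda>x. \<Sum>i\<in>I. f i x * c i) y = (\<Sum>i\<in>I. A (f i) y * c i)"
proof -
  have A: "A (f + g) = A f + A g" "A (\<lambda>x. c * f x) = (\<lambda>y. c * A f y)" for f g c
    using assms unfolding linear_op_def by blast+
  have A0: "A (\<lambda>x. 0) = (\<lambda>y. 0)"
    using A(2)[of 0 "\<lambda>x. 0"] by simp
  show ?thesis
  proof (induction I rule: infinite_finite_induct)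
    case (insert j J)
    have "(\<lambda>x. \<Sum>i\<in>insert j J. f i x * c i) =
        (\<lambda>x. c j * f j x) + (\<lambda>x. \<Sum>i\<in>J. f i x * c i)"
      using insert by (auto simp: mult.commute)
    then show ?case
      using insert by (simp add: A mult.commute)
  qed (simp_all add: A0)
qed

lemma tensor_map3_sum_tensor3:
  assumes "linear_op A" "linear_op B" "linear_op C"
  shows "tensor_map3 A B C (\<Sum>i\<in>I. tensor3 (\<alpha> i) (\<beta> i) (\<gamma> i)) =
         (\<Sum>i\<in>I. tensor3 (A (\<alpha> i)) (B (\<beta> i)) (C (\<gamma> i)))"
proof (intro ext)
  fix x y z
  have "(\<lambda>c. (\<Sum>i\<in>I. tensor3 (\<alpha> i) (\<beta> i) (\<gamma> i)) a b c) =
      (\<lambda>c. \<Sum>i\<in>I. \<gamma> i c * (\<alpha> i a * \<beta> i b))" for a b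
    by (simp add: sum_fun_eval tensor3_def mult_ac)
  then have "C (\<lambda>c. (\<Sum>i\<in>I. tensor3 (\<alpha> i) (\<beta> i) (\<gamma> i)) a b c) z =
      (\<Sum>i\<in>I. \<beta> i b * (\<alpha> i a * C (\<gamma> i) z))" for a b
    by (simp only: linear_op_sum[OF assms(3)]) (simp add: mult_ac)
  moreover have "B (\<lambda>b. \<Sum>i\<in>I. \<beta> i b * (\<alpha> i a * C (\<gamma> i) z)) y =
      (\<Sum>i\<in>I. \<alpha> i a * (B (\<beta> i) y * C (\<gamma> i) z))" for a
    by (subst linear_op_sum[OF assms(2)]) (simp add: mult_ac)
  moreover have "A (\<lambda>a. \<Sum>i\<in>I. \<alpha> i a * (B (\<beta> i) y * C (\<gamma> i) z)) x =
      (\<Sum>i\<in>I. A (\<alpha> i) x * (B (\<beta> i) y * C (\<gamma> i) z))"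
    by (rule linear_op_sum[OF assms(1)])
  ultimately show "tensor_map3 A B C (\<Sum>i\<in>I. tensor3 (\<alpha> i) (\<beta> i) (\<gamma> i)) x y z =
      (\<Sum>i\<in>I. tensor3 (A (\<alpha> i)) (B (\<beta> i)) (C (\<gamma> i))) x y z"
    by (simp add: tensor_map3_def sum_fun_eval tensor3_def mult.assoc)
qed


definition eform :: "(nat \<Rightarrow> 'v::real_vector) \<Rightarrow> nat list \<Rightarrow> 'v form" where
  "eform v is = wedge (map (dual v) is)"

definition I3_vec :: "(nat \<Rightarrow> 'v::real_vector) \<Rightarrow> 'v form list" where
  "I3_vec v = [eform v [1,2,3], - eform v [0,2,3], eform v [0,1,3], - eform v [0,1,2]]"

definition I3_mat :: "(nat \<Rightarrow> 'v::real_vector) \<Rightarrow> 'v form list list" where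
  "I3_mat v =
     [[0,                 eform v [0,1],     eform v [0,2],     eform v [0,3]],
      [- eform v [0,1],   0,                 eform v [1,2],     eform v [1,3]],
      [- eform v [0,2],   - eform v [1,2],   0,                 eform v [2,3]],
      [- eform v [0,3],   - eform v [1,3],   - eform v [2,3],   0]]"

definition I3 :: "(nat \<Rightarrow> 'v::real_vector) \<Rightarrow> 'v list \<Rightarrow> 'v list \<Rightarrow> 'v list \<Rightarrow> real" where
  "I3 v = (\<Sum>i<4. \<Sum>j<4. tensor3 (I3_vec v ! i) (I3_mat v ! i ! j) (I3_vec v ! j))"


(* The element \<open>(r, u)\<close> of the Euclidean group (where \<open>r\<close> is a rotation), as a linear map of \<open>V\<close>: in
   the basis \<open>v\<close> its matrix, acting on columns, has the block rows \<open>(1, 0)\<close> and \<open>(u, r)\<close>. *)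

definition spatial :: "(nat \<Rightarrow> 'v::real_vector) \<Rightarrow> real^3 \<Rightarrow> 'v" where
  "spatial v a = a $ 1 *\<^sub>R v 1 + a $ 2 *\<^sub>R v 2 + a $ 3 *\<^sub>R v 3"

definition euclid :: "(nat \<Rightarrow> 'v::real_vector) \<Rightarrow> real^3^3 \<Rightarrow> real^3 \<Rightarrow> 'v \<Rightarrow> 'v" where
  "euclid v r u x =
     (let x0 = dual v 0 x; x' = vector [dual v 1 x, dual v 2 x, dual v 3 x]
      in x0 *\<^sub>R v 0 + spatial v (x0 *\<^sub>R u + r *v x'))"


(* \<open>V/[v\<^sub>0]\<close> is the set of cosets \<open>coset (v 0) x\<close>. *)

definition coset :: "'v::real_vector \<Rightarrow> 'v \<Rightarrow> 'v set" where
  "coset v0 x = {x + c *\<^sub>R v0 | c. True}"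

(* \<open>psi v \<xi>\<close> is the function on \<open>GL(V)\<close> with values in forms on \<open>V/[v\<^sub>0]\<close>, taken as a function of
   the pair (group element, list of cosets).  On decomposable \<open>y\<close> it is \<open>\<xi> (g (v\<^sub>0 \<and> y))\<close>; as \<open>\<xi>\<close>
   is alternating, the choice of representatives of the cosets is immaterial. *)

definition psi ::
  "(nat \<Rightarrow> 'v::real_vector) \<Rightarrow> 'v form \<Rightarrow> ('v \<Rightarrow> 'v) \<times> 'v set list \<Rightarrow> real" where
  "psi v \<xi> = (\<lambda>(g, Y). \<xi> (map g (v 0 # map (\<lambda>y. SOME x. x \<in> y) Y)))"

lemma linear_op_psi: "linear_op (psi v)"
  by (auto simp: linear_op_def psi_def)

(* \<open>T\<close> is identified with \<open>V/[v\<^sub>0]\<close> by means of \<open>v\<^sub>0\<close>, so this takes values in tensors on \<open>T\<close>. *)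

definition euclidean_reduction ::
  "(nat \<Rightarrow> 'v::real_vector) \<Rightarrow> ('v list \<Rightarrow> 'v list \<Rightarrow> 'v list \<Rightarrow> real) \<Rightarrow> ('v \<Rightarrow> 'v) \<Rightarrow> ('v \<Rightarrow> 'v) \<Rightarrow>
   'v set list \<Rightarrow> 'v set list \<Rightarrow> 'v set list \<Rightarrow> real" where
  "euclidean_reduction v F g1 g2 Y1 Y2 Y3 =
     tensor_map3 (psi v) (psi v) (psi v) F (inv g1, Y1) (id, Y2) (inv g2, Y3)"

(* The isomorphism from \<open>\<real>\<^sup>3\<close> to \<open>T\<close> given by the basis induced by \<open>v\<^sub>1, v\<^sub>2, v\<^sub>3\<close>, and the transport
   of tensors on \<open>T\<close> to tensors on \<open>\<real>\<^sup>3\<close> along it. *)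

definition T_of :: "(nat \<Rightarrow> 'v::real_vector) \<Rightarrow> real^3 \<Rightarrow> 'v set" where
  "T_of v a = coset (v 0) (spatial v a)"

definition on_R3 ::
  "(nat \<Rightarrow> 'v::real_vector) \<Rightarrow> ('v set list \<Rightarrow> 'v set list \<Rightarrow> 'v set list \<Rightarrow> real) \<Rightarrow>
   (real^3) list \<Rightarrow> (real^3) list \<Rightarrow> (real^3) list \<Rightarrow> real" where
  "on_R3 v F a b c = F (map (T_of v) a) (map (T_of v) b) (map (T_of v) c)"

definition et :: "3 \<Rightarrow> (real^3) form" where
  "et i = wedge [\<lambda>a. a $ i]"

definition two_form :: "real^3 \<Rightarrow> (real^3) form" where
  "two_form x = interior x (wedge [\<lambda>a. a $ 1, \<lambda>a. a $ 2, \<lambda>a. a $ 3])"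

end

(* Write g = (r,u), so that g^-1 = (r^T, -r^T u).  For a form \<xi> of degree 3, the value
   \<xi> (g^-1 (v_0 \<and> a \<and> b)) is \<xi> (v_0 - r^T u, r^T a, r^T b), and r^T a \<times> r^T b = r^T (a \<times> b)
   because r is a rotation.  Hence psi, evaluated at g^-1, sends the row (e_123, -e_023, e_013, -e_012)
   to -(u, r_1, r_2, r_3), with vectors in T regarded as 2-forms, and evaluated at the identity it
   sends e_0i to the i-th coordinate form and the other e_ij to 0.  Only the first row and the
   first column of the matrix survive; they give u \<otimes> s and -r \<otimes> w. *)

theory Submission
  imports Defs
begin

unbundle cross3_syntax

lemma wedge_2:
  "wedge [\<alpha>, \<beta>] xs =
    (if length xs = 2 then \<alpha> (xs ! 0) * \<beta> (xs ! 1) - \<alpha> (xs ! 1) * \<beta> (xs ! 0) else 0)"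
proof -
  have 1: "{..<length [\<alpha>, \<beta>]} = insert 0 {Suc 0}"
    by auto
  have 2: "finite {Suc 0}" "0 \<notin> {Suc 0}"
    by auto
  show ?thesis
    unfolding wedge_def 1 sum_over_permutations_insert[OF 2] permutes_sing
    by (simp add: sign_swap_id sign_id)
qed

lemma wedge_3:
  "wedge [\<alpha>, \<beta>, \<gamma>] xs =
    (if length xs = 3 then
       \<alpha> (xs ! 0) * (\<beta> (xs ! 1) * \<gamma> (xs ! 2) - \<beta> (xs ! 2) * \<gamma> (xs ! 1))
     - \<alpha> (xs ! 1) * (\<beta> (xs ! 0) * \<gamma> (xs ! 2) - \<beta> (xs ! 2) * \<gamma> (xs ! 0))
     + \<alpha> (xs ! 2) * (\<beta> (xs ! 0) * \<gamma> (xs ! 1) - \<beta> (xs ! 1) * \<gamma> (xs ! 0))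
     else 0)"
proof -
  have 1: "{..<length [\<alpha>, \<beta>, \<gamma>]} = insert 0 (insert (Suc 0) {2})"
    by auto
  have 2: "finite {2}" "Suc 0 \<notin> {2}" "finite {Suc 0, 2}" "0 \<notin> {Suc 0, 2}"
    by auto
  \<comment> \<open>A permutation of {0, 1, 2} is a permutation of {1, 2} followed by a swap of 0
    with its image; summing over that image gives the Laplace expansion along \<alpha>.\<close>
  show ?thesis
    unfolding wedge_def 1 sum_over_permutations_insert[OF 2(3,4)]
      sum_over_permutations_insert[OF 2(1,2)] permutes_sing
    by (simp add: sign_swap_id sign_id sign_compose permutation_swap_id permutation_compose
        transpose_apply_other numeral_2_eq_2 algebra_simps)
qed

text \<open>The contracted determinant is the scalar triple product, so the behaviour of these forms
  under rotations follows from that of the cross product.\<close>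

lemma two_form_eq:
  "two_form x ys = (if length ys = 2 then x \<bullet> (ys ! 0 \<times> ys ! 1) else 0)"
  by (simp add: two_form_def interior_def wedge_3 inner_vec_def sum_3 cross3_def numeral_2_eq_2
      algebra_simps)

lemma et_eq: "et i ys = (if length ys = 1 then ys ! 0 $ i else 0)"
proof -
  have "{..<length [\<lambda>a::real^3. a $ i]} = {0}"
    by auto
  then show ?thesis
    by (simp add: et_def wedge_def permutes_sing sign_id)
qed

context
  fixes v :: "nat \<Rightarrow> 'v::real_vector"
  assumes v: "basis4 v"
begin

lemma dual_add: "dual v i (x + y) = dual v i x + dual v i y"
  and dual_scaleR: "dual v i (c *\<^sub>R x) = c * dual v i x"
  using v by (simp_all add: basis4_def dual_def representation_add representation_scale)

lemma dual_basis:
  assumes "i \<le> 3" "j \<le> 3"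
  shows "dual v i (v j) = (if i = j then 1 else 0)"
proof -
  have "v i = v j \<longleftrightarrow> i = j"
    using v assms by (auto simp: basis4_def inj_on_def)
  then show ?thesis
    using v assms by (auto simp: basis4_def dual_def representation_basis)
qed

lemma dual_spatial:
  "dual v 0 (spatial v a) = 0"
  "dual v (Suc 0) (spatial v a) = a $ 1"
  "dual v 2 (spatial v a) = a $ 2"
  "dual v 3 (spatial v a) = a $ 3"
  by (simp_all add: spatial_def dual_add dual_scaleR dual_basis)

lemma dual_expansion:
  "x = dual v 0 x *\<^sub>R v 0 + spatial v (vector [dual v 1 x, dual v 2 x, dual v 3 x])"
proof -
  have B: "independent (v ` {0..3})" "x \<in> span (v ` {0..3})" "inj_on v {0..3}"
    using v by (auto simp: basis4_def)
  have "x = (\<Sum>b\<in>v ` {0..3}. representation (v ` {0..3}) x b *\<^sub>R b)"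
    using sum_representation_eq[OF B(1,2)] by simp
  also have "\<dots> = (\<Sum>i\<in>{0..3}. dual v i x *\<^sub>R v i)"
    by (simp add: sum.reindex[OF B(3)] dual_def)
  also have "{0..3} = {0, 1, 2, 3::nat}"
    by auto
  finally show ?thesis
    by (simp add: spatial_def algebra_simps)
qed

text \<open>\<open>euclid\<close> reads the last three coordinates only as one vector; bundled in
  this way, they can be rewritten directly in a composition.\<close>

lemma dual_euclid:
  "dual v 0 (euclid v r u x) = dual v 0 x"
  "vector [dual v (Suc 0) (euclid v r u x), dual v 2 (euclid v r u x), dual v 3 (euclid v r u x)] =
    dual v 0 x *\<^sub>R u + r *v vector [dual v 1 x, dual v 2 x, dual v 3 x]"
  by (simp_all add: euclid_def Let_def dual_add dual_scaleR dual_basis dual_spatial vec_eq_iff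
      forall_3)

text \<open>Block multiplication of the matrices: the group law of a semidirect product.\<close>

lemma euclid_comp:
  "euclid v r u (euclid v s w x) = euclid v (r ** s) (u + r *v w) x"
  by (simp add: euclid_def[of v r] euclid_def[of v "r ** s"] Let_def dual_euclid
      matrix_vector_right_distrib matrix_vector_mul_assoc algebra_simps
      matrix_vector_mult_scaleR)

lemma euclid_id: "euclid v (mat 1) 0 x = x"
  using dual_expansion[of x] by (simp add: euclid_def Let_def)

lemma inv_euclid:
  assumes "rotation_matrix r"
  shows "inv (euclid v r u) = euclid v (transpose r) (- (transpose r *v u))"
proof -
  have "transpose r ** r = mat 1" "r ** transpose r = mat 1"
    using assms by (simp_all add: rotation_matrix_def orthogonal_matrix_def)
  then show ?thesis
    by (intro inv_equality)
       (simp_all add: euclid_comp matrix_vector_mul_assoc euclid_id vec.neg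
         del: transpose_matrix_vector)
qed

text \<open>\<open>psi\<close> evaluates forms at representatives picked by \<open>SOME\<close>.
  They contain an unknown multiple of \<open>v 0\<close>, which has to cancel in each
  evaluation.\<close>

lemma some_T_of: "\<exists>c. (SOME x. x \<in> T_of v a) = spatial v a + c *\<^sub>R v 0"
proof -
  have "spatial v a + 0 *\<^sub>R v 0 \<in> T_of v a"
    unfolding T_of_def coset_def by blast
  then have "(SOME x. x \<in> T_of v a) \<in> T_of v a"
    by (rule someI)
  then show ?thesis
    by (auto simp: T_of_def coset_def)
qed

lemma dual_some_T_of:
  "dual v (Suc 0) (SOME x. x \<in> T_of v a) = a $ 1"
  "dual v 2 (SOME x. x \<in> T_of v a) = a $ 2"
  "dual v 3 (SOME x. x \<in> T_of v a) = a $ 3"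
proof -
  obtain c where "(SOME x. x \<in> T_of v a) = spatial v a + c *\<^sub>R v 0"
    using some_T_of by blast
  then show "dual v (Suc 0) (SOME x. x \<in> T_of v a) = a $ 1"
    "dual v 2 (SOME x. x \<in> T_of v a) = a $ 2"
    "dual v 3 (SOME x. x \<in> T_of v a) = a $ 3"
    by (simp_all add: dual_add dual_scaleR dual_basis dual_spatial)
qed

text \<open>The first argument of the form is \<open>v 0\<close>, on which coordinate 0 is 1 and the
  others vanish. The unknown coordinate 0 of a representative is thus multiplied by 0.\<close>

lemma psi_eform_2:
  "psi v (eform v [0,1]) (id, map (T_of v) ys) = et 1 ys"
  "psi v (eform v [0,2]) (id, map (T_of v) ys) = et 2 ys"
  "psi v (eform v [0,3]) (id, map (T_of v) ys) = et 3 ys"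
  "psi v (eform v [1,2]) (id, map (T_of v) ys) = 0"
  "psi v (eform v [1,3]) (id, map (T_of v) ys) = 0"
  "psi v (eform v [2,3]) (id, map (T_of v) ys) = 0"
  by (auto simp: psi_def eform_def wedge_2 et_eq dual_basis dual_some_T_of length_Suc_conv
      numeral_2_eq_2[symmetric])

text \<open>The forms with index 0 read off the entries of a cross product; the middle one,
  \<open>e_013\<close>, gives its second entry with the opposite sign. The form \<open>e_123\<close>
  gives a triple product with the translation part of the inverse.\<close>

lemma psi_eform_3:
  assumes r: "rotation_matrix r"
  shows "psi v (eform v [1,2,3]) (inv (euclid v r u), map (T_of v) ys) = - two_form u ys" (is ?A)
    and "psi v (eform v [0,2,3]) (inv (euclid v r u), map (T_of v) ys) = two_form (column 1 r) ys" (is ?B)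
    and "psi v (eform v [0,1,3]) (inv (euclid v r u), map (T_of v) ys) = - two_form (column 2 r) ys" (is ?C)
    and "psi v (eform v [0,1,2]) (inv (euclid v r u), map (T_of v) ys) = two_form (column 3 r) ys" (is ?D)
proof -
  have "?A \<and> ?B \<and> ?C \<and> ?D"
  proof (cases "length ys = 2")
    \<comment> \<open>\<open>psi\<close> prepends \<open>v 0\<close>, so the 3-form receives a list
      of length other than 3 and both sides take the default value 0.\<close>
    case False
    then show ?thesis
      by (simp add: psi_def eform_def wedge_3 two_form_eq numeral_2_eq_2 numeral_3_eq_3)
  next
    case True
    then obtain a b where ys: "ys = [a, b]"
      by (auto simp: length_Suc_conv numeral_2_eq_2)
    obtain c d where cd: "(SOME x. x \<in> T_of v a) = spatial v a + c *\<^sub>R v 0"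
      "(SOME x. x \<in> T_of v b) = spatial v b + d *\<^sub>R v 0"
      using some_T_of by meson
    \<comment> \<open>The inverse of \<open>(r, u)\<close> is \<open>(R, p)\<close>.\<close>
    define R where "R = transpose r"
    define p where "p = - (R *v u)"
    define h where "h = euclid v R p"
    define \<alpha> \<beta> where "\<alpha> = R *v a" and "\<beta> = R *v b"
    have rot: "rotation_matrix R"
      using r by (simp add: R_def rotation_matrix_def orthogonal_matrix_transpose)
    have h: "h (spatial v y + t *\<^sub>R v 0) = t *\<^sub>R v 0 + spatial v (t *\<^sub>R p + R *v y)" for y t
    proof -
      have "vector [y $ 1, y $ 2, y $ 3] = y"
        by (simp add: vec_eq_iff forall_3)
      then show ?thesis
        by (simp add: h_def euclid_def Let_def dual_add dual_scaleR dual_basis dual_spatial)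
    qed
    have h0: "h (v 0) = v 0 + spatial v p"
      using h[of 0 1] by (simp add: spatial_def)
    have eq: "psi v \<xi> (inv (euclid v r u), map (T_of v) ys) =
        \<xi> [v 0 + spatial v p, c *\<^sub>R v 0 + spatial v (c *\<^sub>R p + \<alpha>), d *\<^sub>R v 0 + spatial v (d *\<^sub>R p + \<beta>)]"
      for \<xi>
      by (simp add: psi_def ys inv_euclid[OF r] cd h h0 \<alpha>_def \<beta>_def
          flip: R_def p_def h_def)
    \<comment> \<open>This is where determinant 1 enters: a reflection would change the
      sign.\<close>
    have cross: "R *v (a \<times> b) = \<alpha> \<times> \<beta>"
      by (simp add: \<alpha>_def \<beta>_def cross_rotation_matrix[OF rot])
    have col: "two_form (column i r) ys = (\<alpha> \<times> \<beta>) $ i" for i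
      by (simp add: two_form_eq ys R_def transpose_def column_def matrix_vector_mult_def
          inner_vec_def flip: cross)
    \<comment> \<open>As \<open>p\<close> is \<open>- (R *v u)\<close> and the cross product is
      \<open>R *v (a \<times> b)\<close>, orthogonality removes \<open>R\<close> from both
      factors.\<close>
    have u: "- two_form u ys = p \<bullet> (\<alpha> \<times> \<beta>)"
    proof -
      have "p \<bullet> (\<alpha> \<times> \<beta>) = - (u \<bullet> (transpose R *v (\<alpha> \<times> \<beta>)))"
        by (simp add: p_def dot_lmul_matrix[symmetric] inner_commute)
      also have "transpose R *v (\<alpha> \<times> \<beta>) = a \<times> b"
        using rot by (simp add: matrix_vector_mul_assoc rotation_matrix_def orthogonal_matrix_def
            flip: cross)
      finally show ?thesis
        by (simp add: two_form_eq ys)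
    qed
    \<comment> \<open>The second and third arguments contain \<open>c\<close> and \<open>d\<close>
      times the first one; these multiples cancel because the form is alternating.\<close>
    show ?thesis
      unfolding col u eq
      by (simp add: eform_def wedge_3 dual_add dual_scaleR dual_basis dual_spatial
          inner_vec_def sum_3 cross3_def algebra_simps)
  qed
  then show ?A ?B ?C ?D
    by blast+
qed

end

theorem mainTheorem5:
  fixes v :: "nat \<Rightarrow> 'v::real_vector"
    and r s :: "real^3^3" and u w :: "real^3"
  assumes "basis4 v"
    and "rotation_matrix r" and "rotation_matrix s"
  shows "on_R3 v (euclidean_reduction v (I3 v) (euclid v r u) (euclid v s w)) =
    (\<Sum>i\<in>UNIV. - tensor3 (two_form (column i r)) (et i) (two_form w)
             + tensor3 (two_form u) (et i) (two_form (column i s)))"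
proof (intro ext)
  fix a b c
  have uminus: "psi v (- \<xi>) y = - psi v \<xi> y" and zero: "psi v 0 y = 0" for \<xi> y
    by (auto simp: psi_def split: prod.split)
  have psi_sum: "tensor_map3 (psi v) (psi v) (psi v) (I3 v) x y z =
    (\<Sum>i<4. \<Sum>j<4. psi v (I3_vec v ! i) x * psi v (I3_mat v ! i ! j) y * psi v (I3_vec v ! j) z)"
    for x y z
    unfolding I3_def sum.cartesian_product
    by (simp add: case_prod_unfold tensor_map3_sum_tensor3 linear_op_psi sum_fun_eval tensor3_def)
  \<comment> \<open>Six of the 16 terms survive. In row 0 the two minus signs of the outer factors
    cancel; in column 0 the sign of the matrix entry is a third one.\<close>
  show "on_R3 v (euclidean_reduction v (I3 v) (euclid v r u) (euclid v s w)) a b c =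
    (\<Sum>i\<in>UNIV. - tensor3 (two_form (column i r)) (et i) (two_form w)
             + tensor3 (two_form u) (et i) (two_form (column i s))) a b c"
    using psi_eform_3[OF assms(1,2), of u a] psi_eform_3[OF assms(1,3), of w c]
      psi_eform_2[OF assms(1), of b]
    by (simp add: on_R3_def euclidean_reduction_def psi_sum I3_vec_def I3_mat_def uminus zero
        sum_fun_eval sum_3 tensor3_def numeral_eq_Suc lessThan_Suc algebra_simps)
qed

end
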